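(* (1) Let $\mathbb{P}_\tau=(P_o,P_a,\vDash,\mathcal{F}_\tau)$ be a multiplicative attribute continuous formal context. Then $(\mathfrak{B}(P_a,\mathcal{F}_\tau),\subseteq)$ is a stably continuous semilattice. (2) For any stably continuous semilattice $(D,\leq)$ with a basis $B_D$, the associated attribute continuous formal context $Rep(D)=(D,B_D,\geq,\mathcal{F}_\tau)$ is multiplicative.
   Context: Domain theory. Posets are assumed nonempty. A dcpo is a poset in which every directed (nonempty, upward directed) subset has a least upper bound. In a dcpo $P$, $x\ll y$ means: for every directed $D\subseteq P$ with $y\leq\bigvee D$ there is $d\in D$ with $x\leq d$. A basis of $P$ is a subset $B\subseteq P$ such that for every $x\in P$ the set $\{b\in B: b\ll x\}$ is directed with least upper bound $x$. A continuous domain is a dcpo that has a basis. A semilattice is a poset in which any two elements $x,y$ have a greatest lower bound $x\wedge y$. A stably continuous semilattice is a continuous domain that is a semilattice and in which $\ll$ is multiplicative: $x\ll y$ and $x\ll z$ imply $x\ll y\wedge z$. Notation: $M\sqsubseteq X$ means that $M$ is a finite subset of $X$ (possibly empty). A formal context is a triple $(P_o,P_a,\vDash)$ with sets $P_o$ (objects), $P_a$ (attributes) and a relation $\vDash\subseteq P_o\times P_a$. Define $\alpha(A)=\{n\in P_a:\forall m\in A,\ m\vDash n\}$ for $A\subseteq P_o$ and $\omega(B)=\{m\in P_o:\forall n\in B,\ m\vDash n\}$ for $B\subseteq P_a$. A kernel attribute operator on $(P_o,P_a,\vDash)$ is a map $\tau:\mathcal{P}(P_a)\to\mathcal{P}(P_a)$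 such that for all $B,B_1\subseteq P_a$: $\tau(\alpha(\omega(B)))\subseteq\alpha(\omega(B))$; $\tau(\tau(\alpha(\omega(B))))=\tau(\alpha(\omega(B)))$; and $\tau(\alpha(\omega(B)))\subseteq\tau(\alpha(\omega(B_1)))$ whenever $B\subseteq B_1$. Write $\lceil B\rceil=\tau(\alpha(\omega(B)))$. A $\tau$-consistent selection is a nonempty family $\mathcal{F}_\tau$ of nonempty finite subsets of $P_a$ such that for every $F\in\mathcal{F}_\tau$ and every $M\sqsubseteq\lceil F\rceil$ there is $G\in\mathcal{F}_\tau$ with $M\subseteq\lceil G\rceil$ and $G\subseteq\lceil F\rceil$. An attribute continuous formal context is a structure $\mathbb{P}_\tau=(P_o,P_a,\vDash,\mathcal{F}_\tau)$ where $(P_o,P_a,\vDash)$ is a formal context, $\tau$ is a kernel attribute operator on it and $\mathcal{F}_\tau$ is a $\tau$-consistent selection. It is called multiplicative if for all $F_1,F_2,G_1,G_2\in\mathcal{F}_\tau$: (SS1) for every $M\sqsubseteq\lceil F_1\rceil\cap\lceil F_2\rceil$ there is $F\in\mathcal{F}_\tau$ with $F\subseteq\lceil F_1\rceil\cap\lceil F_2\rceil$ and $M\subseteq\lceil F\rceil$; (SS2) if $G_1\subseteq\lceil F_1\rceil$ and $G_2\subseteq\lceil F_2\rceil$, then there are $F,G\in\mathcal{F}_\tau$ with $\lceil G_1\rceil\cap\lceil G_2\rceil\subseteq\lceil G\rceil$ and $G\subseteq\lceil F\rceil\subseteq\lceil F_1\rceil\cap\lceil F_2\rceil$. A continuous formal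 concept of $\mathbb{P}_\tau$ is a subset $Q\subseteq P_a$ such that for every $M\sqsubseteq Q$ there is $F\in\mathcal{F}_\tau$ with $M\subseteq\lceil F\rceil\subseteq Q$. The set of all of them is $\mathfrak{B}(P_a,\mathcal{F}_\tau)$. For a continuous domain $(D,\leq)$ with basis $B_D$, the associated attribute continuous formal context $Rep(D)=(D,B_D,\geq,\mathcal{F}_\tau)$ has objects $P_o=D$, attributes $P_a=B_D$, relation $x\vDash b\Leftrightarrow b\leq x$, operator $\tau(X)=\{b\in B_D:\exists x\in X,\ b\ll x\}$ for $X\subseteq B_D$, and $\mathcal{F}_\tau=\{F\sqsubseteq B_D:\bigvee F \text{ exists and } \bigvee F\in F\}$. *)

theory Defs
  imports "HOL-Algebra.Lattice"
begin

section \<open>Continuous domains and stably continuous semilattices\<close>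

definition directed_in :: "('a, 'b) gorder_scheme \<Rightarrow> 'a set \<Rightarrow> bool" where
  "directed_in L D \<longleftrightarrow> D \<subseteq> carrier L \<and> D \<noteq> {} \<and>
     (\<forall>x\<in>D. \<forall>y\<in>D. \<exists>z\<in>D. x \<sqsubseteq>\<^bsub>L\<^esub> z \<and> y \<sqsubseteq>\<^bsub>L\<^esub> z)"

locale dcpo = partial_order L for L (structure) +
  assumes carrier_nonempty: "carrier L \<noteq> {}"
    and directed_lub_exists: "directed_in L D \<Longrightarrow> \<exists>s. is_lub L s D"

definition way_below :: "('a, 'b) gorder_scheme \<Rightarrow> 'a \<Rightarrow> 'a \<Rightarrow> bool" (infix \<open>\<lless>\<index>\<close> 50) where
  "x \<lless>\<^bsub>L\<^esub> y \<longleftrightarrow> x \<in> carrier L \<and> y \<in> carrier L \<and>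
     (\<forall>D s. directed_in L D \<and> is_lub L s D \<and> y \<sqsubseteq>\<^bsub>L\<^esub> s \<longrightarrow> (\<exists>d\<in>D. x \<sqsubseteq>\<^bsub>L\<^esub> d))"

definition is_basis :: "('a, 'b) gorder_scheme \<Rightarrow> 'a set \<Rightarrow> bool" where
  "is_basis L B \<longleftrightarrow> B \<subseteq> carrier L \<and>
     (\<forall>x\<in>carrier L. directed_in L {b \<in> B. b \<lless>\<^bsub>L\<^esub> x} \<and> is_lub L x {b \<in> B. b \<lless>\<^bsub>L\<^esub> x})"

locale continuous_domain = dcpo L for L (structure) +
  assumes basis_exists: "\<exists>B. is_basis L B"

locale stably_continuous_semilattice =
  continuous_domain L + lower_semilattice L for L (structure) +
  assumes way_below_multiplicative: "x \<lless> y \<Longrightarrow> x \<lless> z \<Longrightarrow> x \<lless> y \<sqinter> z"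


section \<open>Attribute continuous formal contexts\<close>

text \<open>The operator \<open>\<tau>\<close>, which the notation \<open>\<P>\<^sub>\<tau> = (P\<^sub>o, P\<^sub>a, \<Turnstile>, \<F>\<^sub>\<tau>)\<close> carries only as a
  subscript, is a field of its own. It is a total function on sets, but only its values on
  subsets of \<open>P\<^sub>a\<close> are ever constrained or used.\<close>

record ('o, 'a) attr_context =
  objects :: "'o set"
  attributes :: "'a set"
  incidence :: "('o \<times> 'a) set"
  kernel_op :: "'a set \<Rightarrow> 'a set"
  selection :: "'a set set"

definition common_attributes :: "('o, 'a) attr_context \<Rightarrow> 'o set \<Rightarrow> 'a set" (\<open>\<alpha>\<index>\<close>) where
  "\<alpha>\<^bsub>P\<^esub> A = {n \<in> attributes P. \<forall>m\<in>A. (m, n) \<in> incidence P}"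

definition common_objects :: "('o, 'a) attr_context \<Rightarrow> 'a set \<Rightarrow> 'o set" (\<open>\<omega>\<index>\<close>) where
  "\<omega>\<^bsub>P\<^esub> B = {m \<in> objects P. \<forall>n\<in>B. (m, n) \<in> incidence P}"

definition ceil :: "('o, 'a) attr_context \<Rightarrow> 'a set \<Rightarrow> 'a set" (\<open>(\<open>open_block\<close>\<lceil>_\<rceil>\<index>)\<close>) where
  "\<lceil>B\<rceil>\<^bsub>P\<^esub> = kernel_op P (\<alpha>\<^bsub>P\<^esub> (\<omega>\<^bsub>P\<^esub> B))"

locale formal_context =
  fixes P :: "('o, 'a) attr_context" (structure)
  assumes incidence_subset: "incidence P \<subseteq> objects P \<times> attributes P"

locale kernel_attribute_operator = formal_context P
  for P :: "('o, 'a) attr_context" (structure) +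
  assumes kernel_op_closed: "B \<subseteq> attributes P \<Longrightarrow> kernel_op P B \<subseteq> attributes P"
    and kernel_contract: "B \<subseteq> attributes P \<Longrightarrow> kernel_op P (\<alpha> (\<omega> B)) \<subseteq> \<alpha> (\<omega> B)"
    and kernel_idem: "B \<subseteq> attributes P \<Longrightarrow>
          kernel_op P (kernel_op P (\<alpha> (\<omega> B))) = kernel_op P (\<alpha> (\<omega> B))"
    and kernel_mono: "B \<subseteq> B\<^sub>1 \<Longrightarrow> B\<^sub>1 \<subseteq> attributes P \<Longrightarrow>
          kernel_op P (\<alpha> (\<omega> B)) \<subseteq> kernel_op P (\<alpha> (\<omega> B\<^sub>1))"

locale attribute_continuous_context = kernel_attribute_operator P
  for P :: "('o, 'a) attr_context" (structure) +
  assumes selection_nonempty: "selection P \<noteq> {}"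
    and selection_members: "F \<in> selection P \<Longrightarrow> finite F \<and> F \<noteq> {} \<and> F \<subseteq> attributes P"
    and selection_consistent: "F \<in> selection P \<Longrightarrow> finite M \<Longrightarrow> M \<subseteq> \<lceil>F\<rceil> \<Longrightarrow>
          \<exists>G\<in>selection P. M \<subseteq> \<lceil>G\<rceil> \<and> G \<subseteq> \<lceil>F\<rceil>"

locale multiplicative_context = attribute_continuous_context P
  for P :: "('o, 'a) attr_context" (structure) +
  assumes SS1: "F\<^sub>1 \<in> selection P \<Longrightarrow> F\<^sub>2 \<in> selection P \<Longrightarrow>
          finite M \<Longrightarrow> M \<subseteq> \<lceil>F\<^sub>1\<rceil> \<inter> \<lceil>F\<^sub>2\<rceil> \<Longrightarrow>
          \<exists>F\<in>selection P. F \<subseteq> \<lceil>F\<^sub>1\<rceil> \<inter> \<lceil>F\<^sub>2\<rceil> \<and> M \<subseteq> \<lceil>F\<rceil>"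
    and SS2: "F\<^sub>1 \<in> selection P \<Longrightarrow> F\<^sub>2 \<in> selection P \<Longrightarrow>
          G\<^sub>1 \<in> selection P \<Longrightarrow> G\<^sub>2 \<in> selection P \<Longrightarrow>
          G\<^sub>1 \<subseteq> \<lceil>F\<^sub>1\<rceil> \<Longrightarrow> G\<^sub>2 \<subseteq> \<lceil>F\<^sub>2\<rceil> \<Longrightarrow>
          \<exists>F\<in>selection P. \<exists>G\<in>selection P.
            \<lceil>G\<^sub>1\<rceil> \<inter> \<lceil>G\<^sub>2\<rceil> \<subseteq> \<lceil>G\<rceil> \<and> G \<subseteq> \<lceil>F\<rceil> \<and> \<lceil>F\<rceil> \<subseteq> \<lceil>F\<^sub>1\<rceil> \<inter> \<lceil>F\<^sub>2\<rceil>"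

definition concepts :: "('o, 'a) attr_context \<Rightarrow> 'a set set" (\<open>\<BB>\<close>) where
  "\<BB> P = {Q. Q \<subseteq> attributes P \<and>
     (\<forall>M. finite M \<and> M \<subseteq> Q \<longrightarrow> (\<exists>F\<in>selection P. M \<subseteq> \<lceil>F\<rceil>\<^bsub>P\<^esub> \<and> \<lceil>F\<rceil>\<^bsub>P\<^esub> \<subseteq> Q))}"

definition concept_poset :: "('o, 'a) attr_context \<Rightarrow> 'a set gorder" where
  "concept_poset P = \<lparr>carrier = \<BB> P, eq = (=), le = (\<subseteq>)\<rparr>"


section \<open>The context associated with a domain and a basis\<close>

definition Rep :: "('d, 'b) gorder_scheme \<Rightarrow> 'd set \<Rightarrow> ('d, 'd) attr_context" where
  "Rep D B = \<lparr>objects = carrier D,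
     attributes = B,
     incidence = {(x, b). x \<in> carrier D \<and> b \<in> B \<and> b \<sqsubseteq>\<^bsub>D\<^esub> x},
     kernel_op = (\<lambda>X. {b \<in> B. \<exists>x\<in>X. b \<lless>\<^bsub>D\<^esub> x}),
     selection = {F. finite F \<and> F \<subseteq> B \<and> (\<exists>s. is_lub D s F \<and> s \<in> F)}\<rparr>"

end

(* In the concept poset directed joins are unions and binary meets are intersections (by SS1), and
   Q\<^sub>1 \<lless> Q\<^sub>2 holds iff Q\<^sub>1 \<subseteq> \<lceil>F\<rceil> for some F in the selection with F \<subseteq> Q\<^sub>2; with this description SS2 is
   multiplicativity of \<lless>. Conversely, in Rep(D) one has \<lceil>F\<rceil> = {b \<in> B. b \<lless> \<Or>F} for F in the
   selection, so all conditions become interpolation statements for \<lless>, with singletons as witnesses. *)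
theory Submission
  imports Defs
begin

lemma way_belowD:
  assumes "x \<lless>\<^bsub>L\<^esub> y" "directed_in L D" "is_lub L s D" "y \<sqsubseteq>\<^bsub>L\<^esub> s"
  shows "\<exists>d\<in>D. x \<sqsubseteq>\<^bsub>L\<^esub> d"
  using assms unfolding way_below_def by blast

section \<open>The poset of continuous formal concepts\<close>

lemma concept_poset_simps [simp]:
  "carrier (concept_poset P) = \<BB> P"
  "Q \<sqsubseteq>\<^bsub>concept_poset P\<^esub> R \<longleftrightarrow> Q \<subseteq> R"
  by (simp_all add: concept_poset_def)

section \<open>The Galois closure \<open>\<alpha> (\<omega> B)\<close> and the operator
  \<open>ceil\<close>\<close>

context kernel_attribute_operator
begin

lemma alpha_subset: "\<alpha> A \<subseteq> attributes P"
  by (auto simp: common_attributes_def)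

lemma alpha_omega_extensive: "B \<subseteq> attributes P \<Longrightarrow> B \<subseteq> \<alpha> (\<omega> B)"
  by (auto simp: common_attributes_def common_objects_def)

text \<open>Every object in \<open>\<omega> C\<close> carries all attributes of
  \<open>\<alpha> (\<omega> C)\<close>, hence those of \<open>B\<close>. So
  \<open>\<omega> C \<subseteq> \<omega> B\<close>, and \<open>\<alpha>\<close> reverses
  inclusions.\<close>

lemma alpha_omega_least:
  assumes "B \<subseteq> \<alpha> (\<omega> C)"
  shows "\<alpha> (\<omega> B) \<subseteq> \<alpha> (\<omega> C)"
proof -
  have "\<omega> C \<subseteq> \<omega> B"
    using assms by (fastforce simp: common_attributes_def common_objects_def)
  then show ?thesis by (auto simp: common_attributes_def)
qed

lemma ceil_subset_attributes: "\<lceil>B\<rceil> \<subseteq> attributes P"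
  unfolding ceil_def by (rule kernel_op_closed[OF alpha_subset])

text \<open>Contraction puts \<open>B\<close> inside the closed set
  \<open>\<alpha> (\<omega> C)\<close>. Monotonicity of the kernel, applied to that closed set in
  place of \<open>C\<close>, ends at \<open>\<lceil>C\<rceil>\<close> because closing twice changes
  nothing.\<close>

lemma ceil_subset_ceil:
  assumes "C \<subseteq> attributes P" "B \<subseteq> \<lceil>C\<rceil>"
  shows "\<lceil>B\<rceil> \<subseteq> \<lceil>C\<rceil>"
proof -
  have "B \<subseteq> \<alpha> (\<omega> C)"
    using kernel_contract[OF assms(1)] assms(2) by (auto simp: ceil_def)
  moreover have "\<alpha> (\<omega> (\<alpha> (\<omega> C))) = \<alpha> (\<omega> C)"
    using alpha_omega_least[of "\<alpha> (\<omega> C)" C] alpha_omega_extensive[OF alpha_subset] by blast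
  ultimately show ?thesis
    using kernel_mono[of B "\<alpha> (\<omega> C)"] alpha_subset by (simp add: ceil_def)
qed

end

section \<open>Approximation of concepts, directed joins and the way-below relation\<close>

context attribute_continuous_context
begin

lemma selection_ceil_mono:
  assumes "G \<in> selection P" "F \<subseteq> \<lceil>G\<rceil>"
  shows "\<lceil>F\<rceil> \<subseteq> \<lceil>G\<rceil>"
  using assms ceil_subset_ceil selection_members by blast

lemma concept_subset_attributes: "Q \<in> \<BB> P \<Longrightarrow> Q \<subseteq> attributes P"
  by (simp add: concepts_def)

text \<open>The definition of a concept places only \<open>\<lceil>F\<rceil>\<close> inside
  \<open>Q\<close>; since the kernel contracts, \<open>F\<close> itself may stick out. Consistency
  repairs this by passing to some \<open>G \<subseteq> \<lceil>F\<rceil>\<close> that still covers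
  \<open>M\<close>.\<close>

lemma concept_approx:
  assumes "Q \<in> \<BB> P" "finite M" "M \<subseteq> Q"
  shows "\<exists>F\<in>selection P. M \<subseteq> \<lceil>F\<rceil> \<and> F \<subseteq> Q \<and> \<lceil>F\<rceil> \<subseteq> Q"
proof -
  obtain F where F: "F \<in> selection P" "M \<subseteq> \<lceil>F\<rceil>" "\<lceil>F\<rceil> \<subseteq> Q"
    using assms unfolding concepts_def by blast
  obtain G where "G \<in> selection P" "M \<subseteq> \<lceil>G\<rceil>" "G \<subseteq> \<lceil>F\<rceil>"
    using selection_consistent[OF F(1) assms(2) F(2)] by blast
  moreover then have "\<lceil>G\<rceil> \<subseteq> \<lceil>F\<rceil>" using selection_ceil_mono[OF F(1)] by simp
  ultimately show ?thesis using F(3) by blast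
qed

text \<open>\<open>F\<close> is finite, so it lies in some
  \<open>\<lceil>G\<rceil> \<subseteq> Q\<close>, which then absorbs
  \<open>\<lceil>F\<rceil>\<close>.\<close>

lemma concept_ceil_subset:
  assumes "Q \<in> \<BB> P" "F \<in> selection P" "F \<subseteq> Q"
  shows "\<lceil>F\<rceil> \<subseteq> Q"
proof -
  obtain G where "G \<in> selection P" "F \<subseteq> \<lceil>G\<rceil>" "\<lceil>G\<rceil> \<subseteq> Q"
    using concept_approx[OF assms(1) _ assms(3)] selection_members[OF assms(2)] by blast
  then show ?thesis using selection_ceil_mono[of G F] by blast
qed

text \<open>This is consistency of the selection, with
  \<open>G \<subseteq> \<lceil>F\<rceil>\<close> turned into
  \<open>\<lceil>G\<rceil> \<subseteq> \<lceil>F\<rceil>\<close>.\<close>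

lemma ceil_concept:
  assumes "F \<in> selection P"
  shows "\<lceil>F\<rceil> \<in> \<BB> P"
proof -
  have "\<exists>G\<in>selection P. M \<subseteq> \<lceil>G\<rceil> \<and> \<lceil>G\<rceil> \<subseteq> \<lceil>F\<rceil>" if "finite M" "M \<subseteq> \<lceil>F\<rceil>" for M
    using selection_consistent[OF assms that] selection_ceil_mono[OF assms] by blast
  then show ?thesis using ceil_subset_attributes by (auto simp: concepts_def)
qed

text \<open>Finite sets behave like compact elements. Points are added one at a time, directedness
  merging two members; the empty set uses that a directed family is nonempty.\<close>

lemma directed_finite_subset:
  assumes "directed_in (concept_poset P) \<D>" "finite M" "M \<subseteq> \<Union>\<D>"
  shows "\<exists>Q\<in>\<D>. M \<subseteq> Q"
  using assms(2,3)
proof (induction M)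
  case empty
  then show ?case using assms(1) by (auto simp: directed_in_def)
next
  case (insert m M)
  then obtain Q R where "Q \<in> \<D>" "M \<subseteq> Q" "R \<in> \<D>" "m \<in> R" by auto
  moreover then obtain S where "S \<in> \<D>" "Q \<subseteq> S" "R \<subseteq> S"
    using assms(1) by (auto simp: directed_in_def) metis
  ultimately show ?case by blast
qed

lemma directed_Union_concept:
  assumes "directed_in (concept_poset P) \<D>"
  shows "\<Union>\<D> \<in> \<BB> P"
proof -
  have sub: "\<D> \<subseteq> \<BB> P"
    using assms by (auto simp: directed_in_def)
  have "\<exists>F\<in>selection P. M \<subseteq> \<lceil>F\<rceil> \<and> \<lceil>F\<rceil> \<subseteq> \<Union>\<D>" if M: "finite M" "M \<subseteq> \<Union>\<D>" for M
  proof -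
    obtain Q where Q: "Q \<in> \<D>" "M \<subseteq> Q"
      using directed_finite_subset[OF assms M] by blast
    then obtain F where "F \<in> selection P" "M \<subseteq> \<lceil>F\<rceil>" "\<lceil>F\<rceil> \<subseteq> Q"
      using concept_approx[of Q M] sub M(1) by blast
    with Q(1) show ?thesis by blast
  qed
  moreover have "\<Union>\<D> \<subseteq> attributes P" using sub concept_subset_attributes by blast
  ultimately show ?thesis by (simp add: concepts_def)
qed

lemma concept_poset_partial_order: "partial_order (concept_poset P)"
  by unfold_locales (auto simp: concept_poset_def)

text \<open>The upper bounds of \<open>\<D>\<close> are the concepts containing its union, so the
  union is the least of them once it is a concept.\<close>

lemma concept_lub_iff:
  assumes "\<D> \<subseteq> \<BB> P" "\<Union>\<D> \<in> \<BB> P"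
  shows "is_lub (concept_poset P) S \<D> \<longleftrightarrow> S = \<Union>\<D>"
proof -
  have "Upper (concept_poset P) \<D> = {S \<in> \<BB> P. \<Union>\<D> \<subseteq> S}"
    using assms(1) by (auto simp: Upper_def)
  with assms(2) show ?thesis by (auto simp: least_def)
qed

lemma concept_directed_lub_iff:
  assumes "directed_in (concept_poset P) \<D>"
  shows "is_lub (concept_poset P) S \<D> \<longleftrightarrow> S = \<Union>\<D>"
  using assms concept_lub_iff[OF _ directed_Union_concept[OF assms]]
  by (simp add: directed_in_def)

lemma concept_poset_dcpo: "dcpo (concept_poset P)"
proof -
  interpret partial_order "concept_poset P" by (rule concept_poset_partial_order)
  \<comment> \<open>The carrier is nonempty because \<open>\<lceil>F\<rceil>\<close> is a concept
    for any member \<open>F\<close> of the selection.\<close>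
  show ?thesis
    using ceil_concept selection_nonempty concept_directed_lub_iff
    by unfold_locales (auto simp: concept_poset_def)
qed

text \<open>The finite set to be approximated inside \<open>Q\<close> is
  \<open>F \<union> G\<close>.\<close>

lemma concept_approx_join:
  assumes "Q \<in> \<BB> P" "F \<in> selection P" "F \<subseteq> Q" "G \<in> selection P" "G \<subseteq> Q"
  shows "\<exists>H\<in>selection P. H \<subseteq> Q \<and> \<lceil>F\<rceil> \<subseteq> \<lceil>H\<rceil> \<and> \<lceil>G\<rceil> \<subseteq> \<lceil>H\<rceil>"
proof -
  obtain H where "H \<in> selection P" "F \<union> G \<subseteq> \<lceil>H\<rceil>" "H \<subseteq> Q"
    using concept_approx[OF assms(1), of "F \<union> G"] assms(3,5)
      selection_members[OF assms(2)] selection_members[OF assms(4)] by auto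
  then show ?thesis using selection_ceil_mono[of H F] selection_ceil_mono[of H G] by blast
qed

text \<open>This canonical directed family with join \<open>Q\<close> is the one against which
  way-below is tested later.\<close>

lemma directed_ceils_below:
  assumes "Q \<in> \<BB> P"
  shows "directed_in (concept_poset P) {\<lceil>F\<rceil> |F. F \<in> selection P \<and> F \<subseteq> Q}"
    and "\<Union>{\<lceil>F\<rceil> |F. F \<in> selection P \<and> F \<subseteq> Q} = Q"
proof -
  let ?D = "{\<lceil>F\<rceil> |F. F \<in> selection P \<and> F \<subseteq> Q}"
  have "\<exists>Z\<in>?D. \<lceil>F\<rceil> \<subseteq> Z \<and> \<lceil>G\<rceil> \<subseteq> Z"
    if "F \<in> selection P" "F \<subseteq> Q" "G \<in> selection P" "G \<subseteq> Q" for F G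
    using concept_approx_join[OF assms that] by blast
  \<comment> \<open>Approximating the empty set yields a member; approximating singletons further
    down shows that the members cover \<open>Q\<close>.\<close>
  moreover have "?D \<noteq> {}"
    using concept_approx[OF assms, of "{}"] by blast
  ultimately show "directed_in (concept_poset P) ?D"
    using ceil_concept by (auto simp: directed_in_def)
  have "q \<in> \<Union>?D" if "q \<in> Q" for q
    using concept_approx[OF assms, of "{q}"] that by auto
  then show "\<Union>?D = Q"
    using concept_ceil_subset[OF assms] by blast
qed

text \<open>Forwards, \<open>Q\<close> is tested against the directed family of all
  \<open>\<lceil>F\<rceil>\<close> with \<open>F \<subseteq> R\<close>, whose join is
  \<open>R\<close>. Backwards, the finite set \<open>F\<close> lies in a single member of any
  directed family covering \<open>R\<close>, and that member then contains
  \<open>\<lceil>F\<rceil>\<close>.\<close>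

lemma concept_way_below_iff:
  assumes "Q \<in> \<BB> P" "R \<in> \<BB> P"
  shows "Q \<lless>\<^bsub>concept_poset P\<^esub> R \<longleftrightarrow> (\<exists>F\<in>selection P. Q \<subseteq> \<lceil>F\<rceil> \<and> F \<subseteq> R)"
proof
  assume "Q \<lless>\<^bsub>concept_poset P\<^esub> R"
  then have "\<exists>Z\<in>{\<lceil>F\<rceil> |F. F \<in> selection P \<and> F \<subseteq> R}. Q \<subseteq> Z"
    using way_belowD[OF _ directed_ceils_below(1)[OF assms(2)], of Q R R]
      concept_directed_lub_iff[OF directed_ceils_below(1)[OF assms(2)], of R]
      directed_ceils_below(2)[OF assms(2)] by simp
  then show "\<exists>F\<in>selection P. Q \<subseteq> \<lceil>F\<rceil> \<and> F \<subseteq> R" by blast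
next
  assume "\<exists>F\<in>selection P. Q \<subseteq> \<lceil>F\<rceil> \<and> F \<subseteq> R"
  then obtain F where F: "F \<in> selection P" "Q \<subseteq> \<lceil>F\<rceil>" "F \<subseteq> R" by blast
  have "\<exists>Z\<in>\<D>. Q \<subseteq> Z" if \<D>: "directed_in (concept_poset P) \<D>" "R \<subseteq> \<Union>\<D>" for \<D>
  proof -
    obtain Z where "Z \<in> \<D>" "F \<subseteq> Z"
      using directed_finite_subset[OF \<D>(1), of F] F \<D>(2) selection_members[OF F(1)] by blast
    moreover from \<open>Z \<in> \<D>\<close> have "Z \<in> \<BB> P"
      using \<D>(1) by (auto simp: directed_in_def)
    ultimately show ?thesis using concept_ceil_subset[OF _ F(1)] F(2) by blast
  qed
  then show "Q \<lless>\<^bsub>concept_poset P\<^esub> R"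
    using assms concept_directed_lub_iff by (auto simp: way_below_def)
qed

text \<open>The sets \<open>\<lceil>F\<rceil>\<close> with \<open>F \<subseteq> Q\<close> are
  cofinal among the concepts way below \<open>Q\<close>, so directedness and the join are inherited
  from them.\<close>

lemma concepts_basis: "is_basis (concept_poset P) (\<BB> P)"
proof -
  have "directed_in (concept_poset P) {R \<in> \<BB> P. R \<lless>\<^bsub>concept_poset P\<^esub> Q} \<and>
        is_lub (concept_poset P) Q {R \<in> \<BB> P. R \<lless>\<^bsub>concept_poset P\<^esub> Q}"
    if Q: "Q \<in> \<BB> P" for Q
  proof -
    define W where "W = {R \<in> \<BB> P. R \<lless>\<^bsub>concept_poset P\<^esub> Q}"
    have W: "R \<in> W \<longleftrightarrow> R \<in> \<BB> P \<and> (\<exists>F\<in>selection P. R \<subseteq> \<lceil>F\<rceil> \<and> F \<subseteq> Q)" for R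
      using concept_way_below_iff[of R Q] Q by (auto simp: W_def)
    then have ceil_W: "\<lceil>F\<rceil> \<in> W" if "F \<in> selection P" "F \<subseteq> Q" for F
      using that ceil_concept by blast
    have "\<exists>Z\<in>W. R \<subseteq> Z \<and> S \<subseteq> Z" if RS: "R \<in> W" "S \<in> W" for R S
    proof -
      obtain F where F: "F \<in> selection P" "R \<subseteq> \<lceil>F\<rceil>" "F \<subseteq> Q" using W RS(1) by blast
      obtain G where G: "G \<in> selection P" "S \<subseteq> \<lceil>G\<rceil>" "G \<subseteq> Q" using W RS(2) by blast
      obtain H where H: "H \<in> selection P" "H \<subseteq> Q" "\<lceil>F\<rceil> \<subseteq> \<lceil>H\<rceil>" "\<lceil>G\<rceil> \<subseteq> \<lceil>H\<rceil>"
        using concept_approx_join[OF Q F(1,3) G(1,3)] by blast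
      show ?thesis
        using order_trans[OF F(2) H(3)] order_trans[OF G(2) H(4)] ceil_W[OF H(1,2)]
        by (intro bexI conjI)
    qed
    moreover have "W \<noteq> {}"
      using concept_approx[OF Q, of "{}"] ceil_W by blast
    ultimately have dir: "directed_in (concept_poset P) W"
      using W by (simp add: directed_in_def subset_iff)
    have "q \<in> \<Union>W" if "q \<in> Q" for q
      using concept_approx[OF Q, of "{q}"] that ceil_W by auto
    moreover have "R \<subseteq> Q" if "R \<in> W" for R
      using that W concept_ceil_subset[OF Q] by blast
    ultimately have "\<Union>W = Q" by blast
    with dir concept_directed_lub_iff[OF dir, of Q] show ?thesis by (simp add: W_def)
  qed
  then show ?thesis by (simp add: is_basis_def)
qed

end

section \<open>Binary meets of concepts and multiplicativity of way-below\<close>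

context multiplicative_context
begin

text \<open>\<open>M\<close> is approximated separately in \<open>Q\<close> and in \<open>R\<close>;
  \<open>SS1\<close> merges the two approximations into one inside the intersection.\<close>

lemma Int_concept:
  assumes "Q \<in> \<BB> P" "R \<in> \<BB> P"
  shows "Q \<inter> R \<in> \<BB> P"
proof -
  have "\<exists>F\<in>selection P. M \<subseteq> \<lceil>F\<rceil> \<and> \<lceil>F\<rceil> \<subseteq> Q \<inter> R" if M: "finite M" "M \<subseteq> Q \<inter> R" for M
  proof -
    obtain F\<^sub>1 where F1: "F\<^sub>1 \<in> selection P" "M \<subseteq> \<lceil>F\<^sub>1\<rceil>" "\<lceil>F\<^sub>1\<rceil> \<subseteq> Q"
      using concept_approx[OF assms(1) M(1)] M(2) by blast
    obtain F\<^sub>2 where F2: "F\<^sub>2 \<in> selection P" "M \<subseteq> \<lceil>F\<^sub>2\<rceil>" "\<lceil>F\<^sub>2\<rceil> \<subseteq> R"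
      using concept_approx[OF assms(2) M(1)] M(2) by blast
    obtain F where "F \<in> selection P" "F \<subseteq> \<lceil>F\<^sub>1\<rceil> \<inter> \<lceil>F\<^sub>2\<rceil>" "M \<subseteq> \<lceil>F\<rceil>"
      using SS1[OF F1(1) F2(1) M(1)] F1(2) F2(2) by blast
    moreover then have "\<lceil>F\<rceil> \<subseteq> \<lceil>F\<^sub>1\<rceil> \<inter> \<lceil>F\<^sub>2\<rceil>"
      using selection_ceil_mono F1(1) F2(1) by simp
    ultimately show ?thesis using F1(3) F2(3) by blast
  qed
  moreover have "Q \<inter> R \<subseteq> attributes P" using concept_subset_attributes[OF assms(1)] by blast
  ultimately show ?thesis by (simp add: concepts_def)
qed

lemma concept_glb_iff:
  assumes "Q \<in> \<BB> P" "R \<in> \<BB> P"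
  shows "is_glb (concept_poset P) S {Q, R} \<longleftrightarrow> S = Q \<inter> R"
proof -
  have "Lower (concept_poset P) {Q, R} = {S \<in> \<BB> P. S \<subseteq> Q \<inter> R}"
    using assms by (auto simp: Lower_def)
  with Int_concept[OF assms] show ?thesis by (auto simp: greatest_def)
qed

text \<open>\<open>meet\<close> is a Hilbert choice among greatest lower bounds, which
  \<open>concept_glb_iff\<close> pins down.\<close>

lemma concept_meet:
  assumes "Q \<in> \<BB> P" "R \<in> \<BB> P"
  shows "Q \<sqinter>\<^bsub>concept_poset P\<^esub> R = Q \<inter> R"
  using concept_glb_iff[OF assms] by (simp add: meet_def inf_def)

text \<open>The set \<open>G\<close> from \<open>SS2\<close> witnesses the claim: \<open>Q
  \<subseteq> \<lceil>G\<^sub>1\<rceil> \<inter> \<lceil>G\<^sub>2\<rceil> \<subseteq>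
  \<lceil>G\<rceil>\<close> and
  \<open>G \<subseteq> \<lceil>F\<rceil> \<subseteq> R \<inter> S\<close>.\<close>

lemma concept_way_below_Int:
  assumes "Q \<in> \<BB> P" "R \<in> \<BB> P" "S \<in> \<BB> P"
    and "Q \<lless>\<^bsub>concept_poset P\<^esub> R" "Q \<lless>\<^bsub>concept_poset P\<^esub> S"
  shows "Q \<lless>\<^bsub>concept_poset P\<^esub> R \<inter> S"
proof -
  obtain G\<^sub>1 where G1: "G\<^sub>1 \<in> selection P" "Q \<subseteq> \<lceil>G\<^sub>1\<rceil>" "G\<^sub>1 \<subseteq> R"
    using assms(4) concept_way_below_iff[OF assms(1,2)] by blast
  obtain G\<^sub>2 where G2: "G\<^sub>2 \<in> selection P" "Q \<subseteq> \<lceil>G\<^sub>2\<rceil>" "G\<^sub>2 \<subseteq> S"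
    using assms(5) concept_way_below_iff[OF assms(1,3)] by blast
  \<comment> \<open>\<open>G\<^sub>1\<close> is finite and so can be approximated inside
    \<open>R\<close>; this supplies the outer set that \<open>SS2\<close> demands.\<close>
  obtain F\<^sub>1 where F1: "F\<^sub>1 \<in> selection P" "G\<^sub>1 \<subseteq> \<lceil>F\<^sub>1\<rceil>" "\<lceil>F\<^sub>1\<rceil> \<subseteq> R"
    using concept_approx[OF assms(2) _ G1(3)] selection_members[OF G1(1)] by blast
  obtain F\<^sub>2 where F2: "F\<^sub>2 \<in> selection P" "G\<^sub>2 \<subseteq> \<lceil>F\<^sub>2\<rceil>" "\<lceil>F\<^sub>2\<rceil> \<subseteq> S"
    using concept_approx[OF assms(3) _ G2(3)] selection_members[OF G2(1)] by blast
  obtain F G where "G \<in> selection P" "\<lceil>G\<^sub>1\<rceil> \<inter> \<lceil>G\<^sub>2\<rceil> \<subseteq> \<lceil>G\<rceil>" "G \<subseteq> \<lceil>F\<rceil>" "\<lceil>F\<rceil> \<subseteq> \<lceil>F\<^sub>1\<rceil> \<inter> \<lceil>F\<^sub>2\<rceil>"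
    using SS2[OF F1(1) F2(1) G1(1) G2(1) F1(2) F2(2)] by blast
  then have "G \<in> selection P \<and> Q \<subseteq> \<lceil>G\<rceil> \<and> G \<subseteq> R \<inter> S"
    using G1(2) G2(2) F1(3) F2(3) by blast
  then show ?thesis
    using concept_way_below_iff[OF assms(1) Int_concept[OF assms(2,3)]] by blast
qed

lemma concept_poset_stably_continuous: "stably_continuous_semilattice (concept_poset P)"
proof -
  interpret dcpo "concept_poset P" by (rule concept_poset_dcpo)
  show ?thesis
  proof unfold_locales
    show "\<exists>B. is_basis (concept_poset P) B" using concepts_basis by blast
    show "\<exists>s. is_glb (concept_poset P) s {Q, R}"
      if "Q \<in> carrier (concept_poset P)" "R \<in> carrier (concept_poset P)" for Q R
      using concept_glb_iff[of Q R] that by simp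
    show "Q \<lless>\<^bsub>concept_poset P\<^esub> R \<sqinter>\<^bsub>concept_poset P\<^esub> S"
      if wb: "Q \<lless>\<^bsub>concept_poset P\<^esub> R" "Q \<lless>\<^bsub>concept_poset P\<^esub> S" for Q R S
    proof -
      \<comment> \<open>Membership in the carrier is built into the definition of way-below.\<close>
      have "Q \<in> \<BB> P" "R \<in> \<BB> P" "S \<in> \<BB> P"
        using wb by (auto simp: way_below_def)
      then show ?thesis using concept_way_below_Int wb by (simp add: concept_meet)
    qed
  qed
qed

end


section \<open>The context of a stably continuous semilattice\<close>

context partial_order
begin

lemma way_below_closed:
  assumes "x \<lless> y"
  shows "x \<in> carrier L" "y \<in> carrier L"
  using assms by (simp_all add: way_below_def)

text \<open>The singleton \<open>{y}\<close> is directed with join \<open>y\<close>.\<close>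

lemma way_below_imp_le:
  assumes "x \<lless> y"
  shows "x \<sqsubseteq> y"
proof -
  have y: "y \<in> carrier L" using assms way_below_closed by blast
  then have "directed_in L {y}" "is_lub L y {y}"
    by (auto simp: directed_in_def intro: least_UpperI)
  then show ?thesis using assms y unfolding way_below_def by blast
qed

lemma way_below_le_trans:
  assumes "x \<lless> y" "y \<sqsubseteq> z" "z \<in> carrier L"
  shows "x \<lless> z"
proof -
  have "\<exists>d\<in>D. x \<sqsubseteq> d" if "directed_in L D" "is_lub L s D" "z \<sqsubseteq> s" for D s
    using assms that le_trans[of y z s] unfolding way_below_def by (meson least_closed)
  then show ?thesis using assms by (auto simp: way_below_def)
qed

lemma le_way_below_trans:
  assumes "x \<sqsubseteq> y" "y \<lless> z" "x \<in> carrier L"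
  shows "x \<lless> z"
proof -
  have "\<exists>d\<in>D. x \<sqsubseteq> d" if D: "directed_in L D" "is_lub L s D" "z \<sqsubseteq> s" for D s
  proof -
    obtain d where d: "d \<in> D" "y \<sqsubseteq> d" using way_belowD[OF assms(2) D] by blast
    have "d \<in> carrier L" using D(1) d(1) by (auto simp: directed_in_def)
    then have "x \<sqsubseteq> d" using le_trans[OF assms(1) d(2)] assms(3) way_below_closed(1)[OF assms(2)] by simp
    with d(1) show ?thesis by blast
  qed
  then show ?thesis using assms by (auto simp: way_below_def)
qed

lemma way_below_trans:
  assumes "x \<lless> y" "y \<lless> z"
  shows "x \<lless> z"
  using assms way_below_le_trans way_below_imp_le way_below_closed by blast

lemma basis_directed: "is_basis L B \<Longrightarrow> x \<in> carrier L \<Longrightarrow> directed_in L {b \<in> B. b \<lless> x}"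
  by (simp add: is_basis_def)

lemma basis_upper:
  assumes B: "is_basis L B" and wb: "b \<lless> x" "c \<lless> x" and BB: "b \<in> B" "c \<in> B"
  shows "\<exists>d\<in>B. d \<lless> x \<and> b \<sqsubseteq> d \<and> c \<sqsubseteq> d"
  using basis_directed[OF B way_below_closed(2)[OF wb(1)]] wb BB
  unfolding directed_in_def by blast

text \<open>The elements of \<open>B\<close> way below some element of \<open>B\<close> that is way below \<open>y\<close> already form a
  directed set with join \<open>y\<close>.\<close>

lemma basis_interpolation:
  assumes B: "is_basis L B" and wb: "x \<lless> y"
  shows "\<exists>b\<in>B. x \<lless> b \<and> b \<lless> y"
proof -
  have y: "y \<in> carrier L" using wb way_below_closed by blast
  have sub: "B \<subseteq> carrier L" using B by (simp add: is_basis_def)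
  define D where "D = {c \<in> B. \<exists>b\<in>B. c \<lless> b \<and> b \<lless> y}"
  have subD: "D \<subseteq> carrier L" using sub by (auto simp: D_def)
  have "\<exists>z\<in>D. c\<^sub>1 \<sqsubseteq> z \<and> c\<^sub>2 \<sqsubseteq> z" if c: "c\<^sub>1 \<in> D" "c\<^sub>2 \<in> D" for c\<^sub>1 c\<^sub>2
  proof -
    obtain b\<^sub>1 b\<^sub>2 where b: "b\<^sub>1 \<in> B" "c\<^sub>1 \<lless> b\<^sub>1" "b\<^sub>1 \<lless> y" "b\<^sub>2 \<in> B" "c\<^sub>2 \<lless> b\<^sub>2" "b\<^sub>2 \<lless> y"
      using c by (auto simp: D_def)
    obtain b where "b \<in> B" "b \<lless> y" "b\<^sub>1 \<sqsubseteq> b" "b\<^sub>2 \<sqsubseteq> b"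
      using basis_upper[OF B b(3,6,1,4)] by blast
    \<comment> \<open>Both elements are pushed way below a common \<open>b\<close>. Directedness of
      the basis elements way below \<open>b\<close> then supplies \<open>z\<close>, and
      \<open>b\<close> witnesses \<open>z \<in> D\<close>.\<close>
    moreover then have cb: "c\<^sub>1 \<lless> b" "c\<^sub>2 \<lless> b"
      using b(2,5) way_below_le_trans way_below_closed(1)[of b y] by blast+
    moreover obtain z where "z \<in> B" "z \<lless> b" "c\<^sub>1 \<sqsubseteq> z" "c\<^sub>2 \<sqsubseteq> z"
      using basis_upper[OF B cb] c by (auto simp: D_def)
    ultimately show ?thesis by (auto simp: D_def)
  qed
  moreover have "D \<noteq> {}"
  proof -
    obtain b where b: "b \<in> B" "b \<lless> y"
      using basis_directed[OF B y] by (auto simp: directed_in_def)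
    then obtain c where "c \<in> B" "c \<lless> b"
      using basis_directed[OF B, of b] sub by (auto simp: directed_in_def)
    with b show ?thesis by (auto simp: D_def)
  qed
  ultimately have dir: "directed_in L D" using subD by (simp add: directed_in_def)
  have "is_lub L y D"
  proof (rule least_UpperI)
    show "c \<sqsubseteq> y" if "c \<in> D" for c
      using that way_below_trans way_below_imp_le by (auto simp: D_def)
    show "y \<sqsubseteq> u" if u: "u \<in> Upper L D" for u
    proof -
      have uc: "u \<in> carrier L" using u by (simp add: Upper_def)
      \<comment> \<open>All basis elements way below \<open>b\<close> lie in \<open>D\<close>, so
        \<open>u\<close> bounds them and hence their join \<open>b\<close>. The same argument one
        level up then gives \<open>y \<sqsubseteq> u\<close>.\<close>
      have "b \<sqsubseteq> u" if b: "b \<in> B" "b \<lless> y" for b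
      proof -
        have "u \<in> Upper L {c \<in> B. c \<lless> b}"
          using u b uc by (auto simp: D_def Upper_def)
        moreover have "is_lub L b {c \<in> B. c \<lless> b}" using B b sub by (auto simp: is_basis_def)
        ultimately show ?thesis by (simp add: least_le)
      qed
      then have "u \<in> Upper L {b \<in> B. b \<lless> y}" using uc by (auto simp: Upper_def)
      moreover have "is_lub L y {b \<in> B. b \<lless> y}" using B y by (auto simp: is_basis_def)
      ultimately show ?thesis by (simp add: least_le)
    qed
  qed (use subD y in auto)
  \<comment> \<open>Testing \<open>x \<lless> y\<close> on \<open>D\<close> gives
    \<open>x \<sqsubseteq> c \<lless> b \<lless> y\<close>, so \<open>b\<close>
    interpolates.\<close>
  then obtain c where "c \<in> D" "x \<sqsubseteq> c"
    using wb dir y unfolding way_below_def by blast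
  moreover then obtain b where "b \<in> B" "c \<lless> b" "b \<lless> y" by (auto simp: D_def)
  ultimately show ?thesis
    using le_way_below_trans[of x c b] way_below_closed(1)[OF wb] by blast
qed

text \<open>By induction on \<open>M\<close>: the interpolant for the smaller set and one between
  \<open>m\<close> and \<open>x\<close> have a common upper bound in the basis that is still way
  below \<open>x\<close>.\<close>

lemma basis_finite_interpolation:
  assumes B: "is_basis L B" and x: "x \<in> carrier L"
    and M: "finite M" "\<And>m. m \<in> M \<Longrightarrow> m \<lless> x"
  shows "\<exists>b\<in>B. b \<lless> x \<and> (\<forall>m\<in>M. m \<lless> b)"
  using M
proof (induction M)
  case empty
  then show ?case using basis_directed[OF B x] by (auto simp: directed_in_def)
next
  case (insert m M)
  then obtain b where b: "b \<in> B" "b \<lless> x" "\<forall>m\<in>M. m \<lless> b" by auto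
  obtain c where c: "c \<in> B" "m \<lless> c" "c \<lless> x"
    using basis_interpolation[OF B, of m x] insert.prems by blast
  obtain d where d: "d \<in> B" "d \<lless> x" "b \<sqsubseteq> d" "c \<sqsubseteq> d"
    using basis_upper[OF B b(2) c(3) b(1) c(1)] by blast
  have "k \<lless> d" if "k \<in> insert m M" for k
    using that b(3) c(2) d(3,4) way_below_le_trans way_below_closed(1)[OF d(2)] by blast
  with d(1,2) show ?case by blast
qed

text \<open>Here \<open>\<omega>\<close> returns the upper bounds of \<open>F\<close>, and a basis
  element is below all of them exactly when it is below the least one.\<close>

lemma Rep_alpha_omega:
  assumes "is_basis L B" "F \<subseteq> B" "is_lub L s F"
  shows "\<alpha>\<^bsub>Rep L B\<^esub> (\<omega>\<^bsub>Rep L B\<^esub> F) = {b \<in> B. b \<sqsubseteq> s}"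
proof -
  have sub: "B \<subseteq> carrier L" using assms(1) by (simp add: is_basis_def)
  have "\<omega>\<^bsub>Rep L B\<^esub> F = Upper L F"
    using assms(2) sub by (auto simp: common_objects_def Rep_def Upper_def)
  then have "\<alpha>\<^bsub>Rep L B\<^esub> (\<omega>\<^bsub>Rep L B\<^esub> F) = {b \<in> B. \<forall>u\<in>Upper L F. b \<sqsubseteq> u}"
    by (auto simp: common_attributes_def Rep_def Upper_def)
  moreover have "(\<forall>u\<in>Upper L F. b \<sqsubseteq> u) \<longleftrightarrow> b \<sqsubseteq> s" if "b \<in> B" for b
  proof
    show "b \<sqsubseteq> s" if "\<forall>u\<in>Upper L F. b \<sqsubseteq> u" using that least_mem[OF assms(3)] by blast
    show "\<forall>u\<in>Upper L F. b \<sqsubseteq> u" if "b \<sqsubseteq> s"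
    proof
      fix u assume u: "u \<in> Upper L F"
      then have "u \<in> carrier L" by (simp add: Upper_def)
      then show "b \<sqsubseteq> u"
        using le_trans[OF that least_le[OF assms(3) u]] \<open>b \<in> B\<close> sub least_closed[OF assms(3)] by blast
    qed
  qed
  ultimately show ?thesis by (simp cong: conj_cong)
qed

text \<open>The kernel keeps what is way below some basis element \<open>x \<sqsubseteq> s\<close>.
  Since \<open>s \<in> F \<subseteq> B\<close>, the choice \<open>x = s\<close> is admissible; this
  is where the join has to belong to \<open>F\<close>.\<close>

lemma Rep_ceil:
  assumes "is_basis L B" "F \<subseteq> B" "is_lub L s F" "s \<in> F"
  shows "\<lceil>F\<rceil>\<^bsub>Rep L B\<^esub> = {b \<in> B. b \<lless> s}"
proof -
  have s: "s \<in> B" "s \<in> carrier L" using assms(2,4) least_closed[OF assms(3)] by blast+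
  have "(\<exists>x. x \<in> B \<and> x \<sqsubseteq> s \<and> b \<lless> x) \<longleftrightarrow> b \<lless> s" for b
    using way_below_le_trans[OF _ _ s(2)] le_refl[OF s(2)] s(1) by blast
  then show ?thesis
    unfolding ceil_def Rep_alpha_omega[OF assms(1-3)] by (simp add: Rep_def Bex_def conj_assoc)
qed

text \<open>The conclusion retains \<open>s \<in> F\<close> so that, for \<open>SS2\<close>, an
  inclusion of \<open>G\<close> in \<open>\<lceil>F\<rceil>\<close> can be read as a relation
  between the joins.\<close>

lemma Rep_selection:
  assumes "is_basis L B" "F \<in> selection (Rep L B)"
  shows "\<exists>s\<in>B. s \<in> F \<and> \<lceil>F\<rceil>\<^bsub>Rep L B\<^esub> = {b \<in> B. b \<lless> s}"
proof -
  obtain s where "F \<subseteq> B" "is_lub L s F" "s \<in> F" using assms(2) by (auto simp: Rep_def)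
  then show ?thesis using Rep_ceil[OF assms(1)] by blast
qed

lemma Rep_singleton:
  assumes "is_basis L B" "b \<in> B"
  shows "{b} \<in> selection (Rep L B)" "\<lceil>{b}\<rceil>\<^bsub>Rep L B\<^esub> = {c \<in> B. c \<lless> b}"
proof -
  have "b \<in> carrier L" using assms by (auto simp: is_basis_def)
  then have lub: "is_lub L b {b}" by (auto intro: least_UpperI)
  then show "{b} \<in> selection (Rep L B)" using assms(2) by (simp add: Rep_def)
  show "\<lceil>{b}\<rceil>\<^bsub>Rep L B\<^esub> = {c \<in> B. c \<lless> b}" using Rep_ceil[OF assms(1) _ lub] assms(2) by simp
qed

text \<open>Contraction holds because way-below implies \<open>\<sqsubseteq>\<close>. Idempotence is
  transitivity of way-below in one direction and interpolation through the basis in the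
  other.\<close>

lemma Rep_kernel_attribute_operator:
  assumes B: "is_basis L B"
  shows "kernel_attribute_operator (Rep L B)"
proof unfold_locales
  let ?R = "Rep L B"
  let ?c = "\<lambda>X. \<alpha>\<^bsub>?R\<^esub> (\<omega>\<^bsub>?R\<^esub> X)"
  have kernel: "kernel_op ?R X = {b \<in> B. \<exists>x\<in>X. b \<lless> x}" for X by (simp add: Rep_def)
  show "incidence ?R \<subseteq> objects ?R \<times> attributes ?R" by (auto simp: Rep_def)
  show "kernel_op ?R X \<subseteq> attributes ?R" for X by (auto simp: Rep_def)
  show "kernel_op ?R (?c X) \<subseteq> ?c X" for X
  proof
    fix b assume "b \<in> kernel_op ?R (?c X)"
    then obtain x where b: "b \<in> B" "x \<in> ?c X" "b \<lless> x" by (auto simp: kernel)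
    have "b \<sqsubseteq> u" if "u \<in> carrier L" "x \<sqsubseteq> u" for u
      using le_trans[OF way_below_imp_le[OF b(3)] that(2) way_below_closed[OF b(3)] that(1)] .
    with b show "b \<in> ?c X"
      by (auto simp: common_attributes_def common_objects_def Rep_def)
  qed
  show "kernel_op ?R (kernel_op ?R (?c X)) = kernel_op ?R (?c X)" for X
  proof
    show "kernel_op ?R (kernel_op ?R (?c X)) \<subseteq> kernel_op ?R (?c X)"
      using way_below_trans by (auto simp: kernel)
    show "kernel_op ?R (?c X) \<subseteq> kernel_op ?R (kernel_op ?R (?c X))"
      unfolding kernel using basis_interpolation[OF B] by blast
  qed
  show "kernel_op ?R (?c X) \<subseteq> kernel_op ?R (?c Y)" if "X \<subseteq> Y" for X Y
  proof -
    have "?c X \<subseteq> ?c Y" using that by (auto simp: common_attributes_def common_objects_def)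
    then show ?thesis by (auto simp: kernel)
  qed
qed

text \<open>Here \<open>x\<close> ranges over the whole carrier because \<open>SS1\<close> takes it
  to be a meet, which need not be a basis element. The witness is the singleton of an interpolating
  basis element.\<close>

lemma Rep_finite_interpolation:
  assumes B: "is_basis L B" and x: "x \<in> carrier L" and "finite M" "M \<subseteq> {b \<in> B. b \<lless> x}"
  shows "\<exists>F\<in>selection (Rep L B). M \<subseteq> \<lceil>F\<rceil>\<^bsub>Rep L B\<^esub> \<and> F \<subseteq> {b \<in> B. b \<lless> x}"
proof -
  obtain b where b: "b \<in> B" "b \<lless> x" "\<And>m. m \<in> M \<Longrightarrow> m \<lless> b"
    using basis_finite_interpolation[OF B x \<open>finite M\<close>] assms(4) by blast
  have "M \<subseteq> \<lceil>{b}\<rceil>\<^bsub>Rep L B\<^esub>" using assms(4) b Rep_singleton(2)[OF B b(1)] by blast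
  with Rep_singleton(1)[OF B b(1)] b show ?thesis by blast
qed

lemma Rep_attribute_continuous:
  assumes B: "is_basis L B" and ne: "carrier L \<noteq> {}"
  shows "attribute_continuous_context (Rep L B)"
proof -
  interpret kernel_attribute_operator "Rep L B"
    by (rule Rep_kernel_attribute_operator[OF B])
  have sub: "B \<subseteq> carrier L" using B by (simp add: is_basis_def)
  show ?thesis
  proof unfold_locales
    obtain x where "x \<in> carrier L" using ne by blast
    \<comment> \<open>The set of basis elements way below \<open>x\<close> is directed, hence
      nonempty.\<close>
    then have "B \<noteq> {}" using basis_directed[OF B] by (auto simp: directed_in_def)
    then show "selection (Rep L B) \<noteq> {}" using Rep_singleton(1)[OF B] by blast
    show "finite F \<and> F \<noteq> {} \<and> F \<subseteq> attributes (Rep L B)" if "F \<in> selection (Rep L B)" for F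
      using that by (auto simp: Rep_def)
    show "\<exists>G\<in>selection (Rep L B). M \<subseteq> \<lceil>G\<rceil>\<^bsub>Rep L B\<^esub> \<and> G \<subseteq> \<lceil>F\<rceil>\<^bsub>Rep L B\<^esub>"
      if F: "F \<in> selection (Rep L B)" and M: "finite M" "M \<subseteq> \<lceil>F\<rceil>\<^bsub>Rep L B\<^esub>" for F M
    proof -
      obtain s where "s \<in> B" "\<lceil>F\<rceil>\<^bsub>Rep L B\<^esub> = {b \<in> B. b \<lless> s}"
        using Rep_selection[OF B F] by blast
      then show ?thesis using Rep_finite_interpolation[OF B, of s M] sub M by auto
    qed
  qed
qed

end

section \<open>Meets and way-below, and the conditions \<open>SS1\<close> and \<open>SS2\<close> for
  \<open>Rep\<close>\<close>

context stably_continuous_semilattice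
begin

lemma way_below_meet_iff:
  assumes "y \<in> carrier L" "z \<in> carrier L"
  shows "x \<lless> y \<sqinter> z \<longleftrightarrow> x \<lless> y \<and> x \<lless> z"
  using way_below_multiplicative[of x y z] way_below_le_trans[OF _ meet_left[OF assms] assms(1)]
    way_below_le_trans[OF _ meet_right[OF assms] assms(2)] by blast

lemma way_below_meet_mono:
  assumes "w \<lless> y" "x \<lless> z"
  shows "w \<sqinter> x \<lless> y \<sqinter> z"
proof -
  have wx: "w \<in> carrier L" "x \<in> carrier L" using assms way_below_closed by blast+
  show ?thesis
    using le_way_below_trans[OF meet_left[OF wx] assms(1) meet_closed[OF wx]]
      le_way_below_trans[OF meet_right[OF wx] assms(2) meet_closed[OF wx]]
    by (rule way_below_multiplicative)
qed

text \<open>The intersection of \<open>\<lceil>F\<^sub>1\<rceil>\<close> and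
  \<open>\<lceil>F\<^sub>2\<rceil>\<close> consists of the basis elements way below the meet of the
  two joins. \<open>SS1\<close> is finite interpolation below that meet, and \<open>SS2\<close>
  interpolates between two such meets.\<close>

lemma Rep_multiplicative:
  assumes B: "is_basis L B"
  shows "multiplicative_context (Rep L B)"
proof -
  let ?R = "Rep L B"
  have sub: "B \<subseteq> carrier L" using B by (simp add: is_basis_def)
  interpret attribute_continuous_context ?R
    by (rule Rep_attribute_continuous[OF B carrier_nonempty])
  show ?thesis
  proof unfold_locales
    fix F\<^sub>1 F\<^sub>2
    assume F: "F\<^sub>1 \<in> selection ?R" "F\<^sub>2 \<in> selection ?R"
    obtain s\<^sub>1 where s1: "s\<^sub>1 \<in> B" "\<lceil>F\<^sub>1\<rceil>\<^bsub>?R\<^esub> = {b \<in> B. b \<lless> s\<^sub>1}"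
      using Rep_selection[OF B F(1)] by blast
    obtain s\<^sub>2 where s2: "s\<^sub>2 \<in> B" "\<lceil>F\<^sub>2\<rceil>\<^bsub>?R\<^esub> = {b \<in> B. b \<lless> s\<^sub>2}"
      using Rep_selection[OF B F(2)] by blast
    have s: "s\<^sub>1 \<in> carrier L" "s\<^sub>2 \<in> carrier L" using s1(1) s2(1) sub by auto
    have int: "\<lceil>F\<^sub>1\<rceil>\<^bsub>?R\<^esub> \<inter> \<lceil>F\<^sub>2\<rceil>\<^bsub>?R\<^esub> = {b \<in> B. b \<lless> s\<^sub>1 \<sqinter> s\<^sub>2}"
      using s1(2) s2(2) way_below_meet_iff[OF s] by blast
    show "\<exists>F\<in>selection ?R. F \<subseteq> \<lceil>F\<^sub>1\<rceil>\<^bsub>?R\<^esub> \<inter> \<lceil>F\<^sub>2\<rceil>\<^bsub>?R\<^esub> \<and> M \<subseteq> \<lceil>F\<rceil>\<^bsub>?R\<^esub>"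
      if "finite M" "M \<subseteq> \<lceil>F\<^sub>1\<rceil>\<^bsub>?R\<^esub> \<inter> \<lceil>F\<^sub>2\<rceil>\<^bsub>?R\<^esub>" for M
      using Rep_finite_interpolation[OF B meet_closed[OF s] that(1)] that(2) unfolding int by blast
    fix G\<^sub>1 G\<^sub>2
    assume G: "G\<^sub>1 \<in> selection ?R" "G\<^sub>2 \<in> selection ?R" "G\<^sub>1 \<subseteq> \<lceil>F\<^sub>1\<rceil>\<^bsub>?R\<^esub>" "G\<^sub>2 \<subseteq> \<lceil>F\<^sub>2\<rceil>\<^bsub>?R\<^esub>"
    obtain t\<^sub>1 where t1: "t\<^sub>1 \<in> B" "\<lceil>G\<^sub>1\<rceil>\<^bsub>?R\<^esub> = {b \<in> B. b \<lless> t\<^sub>1}" "t\<^sub>1 \<in> G\<^sub>1"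
      using Rep_selection[OF B G(1)] by blast
    obtain t\<^sub>2 where t2: "t\<^sub>2 \<in> B" "\<lceil>G\<^sub>2\<rceil>\<^bsub>?R\<^esub> = {b \<in> B. b \<lless> t\<^sub>2}" "t\<^sub>2 \<in> G\<^sub>2"
      using Rep_selection[OF B G(2)] by blast
    \<comment> \<open>The join \<open>t\<^sub>1\<close> is an element of \<open>G\<^sub>1\<close>,
      so the inclusion in \<open>\<lceil>F\<^sub>1\<rceil>\<close> applies to it; likewise for
      \<open>t\<^sub>2\<close>.\<close>
    have "t\<^sub>1 \<lless> s\<^sub>1" "t\<^sub>2 \<lless> s\<^sub>2" using G(3,4) t1(3) t2(3) s1(2) s2(2) by auto
    then have "t\<^sub>1 \<sqinter> t\<^sub>2 \<lless> s\<^sub>1 \<sqinter> s\<^sub>2" by (rule way_below_meet_mono)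
    \<comment> \<open>The meets may lie outside \<open>B\<close>, so two basis elements
      \<open>g \<lless> f\<close> are inserted between them; \<open>{f}\<close> and
      \<open>{g}\<close> become the sets required by \<open>SS2\<close>.\<close>
    then obtain f where f: "f \<in> B" "t\<^sub>1 \<sqinter> t\<^sub>2 \<lless> f" "f \<lless> s\<^sub>1 \<sqinter> s\<^sub>2"
      using basis_interpolation[OF B] by blast
    then obtain g where g: "g \<in> B" "t\<^sub>1 \<sqinter> t\<^sub>2 \<lless> g" "g \<lless> f"
      using basis_interpolation[OF B] by blast
    have "\<lceil>G\<^sub>1\<rceil>\<^bsub>?R\<^esub> \<inter> \<lceil>G\<^sub>2\<rceil>\<^bsub>?R\<^esub> \<subseteq> \<lceil>{g}\<rceil>\<^bsub>?R\<^esub>"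
    proof
      fix b assume "b \<in> \<lceil>G\<^sub>1\<rceil>\<^bsub>?R\<^esub> \<inter> \<lceil>G\<^sub>2\<rceil>\<^bsub>?R\<^esub>"
      then have "b \<in> B" "b \<lless> t\<^sub>1 \<sqinter> t\<^sub>2"
        using t1(2) t2(2) way_below_multiplicative by auto
      then show "b \<in> \<lceil>{g}\<rceil>\<^bsub>?R\<^esub>"
        using way_below_trans[OF _ g(2)] Rep_singleton(2)[OF B g(1)] by simp
    qed
    moreover have "{g} \<subseteq> \<lceil>{f}\<rceil>\<^bsub>?R\<^esub>"
      using Rep_singleton(2)[OF B f(1)] g by blast
    moreover have "\<lceil>{f}\<rceil>\<^bsub>?R\<^esub> \<subseteq> \<lceil>F\<^sub>1\<rceil>\<^bsub>?R\<^esub> \<inter> \<lceil>F\<^sub>2\<rceil>\<^bsub>?R\<^esub>"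
      unfolding int using Rep_singleton(2)[OF B f(1)] way_below_trans[OF _ f(3)] by auto
    ultimately show "\<exists>F\<in>selection ?R. \<exists>G\<in>selection ?R.
        \<lceil>G\<^sub>1\<rceil>\<^bsub>?R\<^esub> \<inter> \<lceil>G\<^sub>2\<rceil>\<^bsub>?R\<^esub> \<subseteq> \<lceil>G\<rceil>\<^bsub>?R\<^esub> \<and> G \<subseteq> \<lceil>F\<rceil>\<^bsub>?R\<^esub> \<and> \<lceil>F\<rceil>\<^bsub>?R\<^esub> \<subseteq> \<lceil>F\<^sub>1\<rceil>\<^bsub>?R\<^esub> \<inter> \<lceil>F\<^sub>2\<rceil>\<^bsub>?R\<^esub>"
      using Rep_singleton(1)[OF B f(1)] Rep_singleton(1)[OF B g(1)] by blast
  qed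
qed

end

theorem proposition3p25:
  fixes P :: "('o, 'a) attr_context"
    and D :: "'d gorder" and B :: "'d set"
  shows "(multiplicative_context P \<longrightarrow> stably_continuous_semilattice (concept_poset P)) \<and>
         (stably_continuous_semilattice D \<and> is_basis D B \<longrightarrow> multiplicative_context (Rep D B))"
  using multiplicative_context.concept_poset_stably_continuous
    stably_continuous_semilattice.Rep_multiplicative by blast

end
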